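(* Let $\widetilde{B}_{p}^n$ be a maximal class of pairwise non-isomorphic locally $p$-biased functions on $\mathbb{Z}^n$. (1) There is a universal constant $C>0$ such that for every even $n>0$, $\left|\widetilde{B}_{1/2}^n\right| \geq C\,2^{\sqrt{n}}/n^{1/4}$. (2) For $n=2^{m}$ a power of two, $\left|\widetilde{B}_{1/n}^n\right|$ is super-exponential in $n$; that is, for every constant $A>1$ one has $\left|\widetilde{B}_{1/n}^n\right|\ge A^n$ for all sufficiently large powers of two $n=2^m$.
   Context: $\mathbb{Z}^n$ is the standard lattice graph ($x\sim y$ iff $x-y=\pm e_i$ for some standard basis vector $e_i$), so every vertex has degree $2n$. A function $f:\mathbb{Z}^n\to\{-1,1\}$ is locally $p$-biased if for every vertex $x$, $|\{y\sim x : f(y)=1\}|/(2n) = p$. Two functions $f,g:\mathbb{Z}^n\to\{-1,1\}$ are isomorphic if there is a graph automorphism $\psi$ of $\mathbb{Z}^n$ with $f\circ\psi=g$, and non-isomorphic otherwise. Cardinalities may be infinite. *)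

theory Defs
  imports Complex_Main "HOL-Library.FuncSet"
begin

text \<open>
  The dimension is a term-level natural number, since the theorem quantifies over it.  Points of
  the lattice and functions on it are extensional, so that functions agreeing on the lattice are
  equal and sets of such functions have the intended cardinality.
\<close>

definition lattice :: "nat \<Rightarrow> (nat \<Rightarrow> int) set" where
  "lattice n = {..<n} \<rightarrow>\<^sub>E UNIV"

definition lattice_adj :: "nat \<Rightarrow> (nat \<Rightarrow> int) \<Rightarrow> (nat \<Rightarrow> int) \<Rightarrow> bool" where
  "lattice_adj n x y \<longleftrightarrow> x \<in> lattice n \<and> y \<in> lattice n \<and>
     (\<exists>i<n. \<exists>s\<in>{1, -1}. \<forall>j<n. x j - y j = (if j = i then s else 0))"

definition lattice_automorphism :: "nat \<Rightarrow> ((nat \<Rightarrow> int) \<Rightarrow> (nat \<Rightarrow> int)) \<Rightarrow> bool" where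
  "lattice_automorphism n \<psi> \<longleftrightarrow> bij_betw \<psi> (lattice n) (lattice n) \<and>
     (\<forall>x\<in>lattice n. \<forall>y\<in>lattice n. lattice_adj n (\<psi> x) (\<psi> y) \<longleftrightarrow> lattice_adj n x y)"

definition locally_biased :: "nat \<Rightarrow> real \<Rightarrow> ((nat \<Rightarrow> int) \<Rightarrow> int) set" where
  "locally_biased n p = {f \<in> lattice n \<rightarrow>\<^sub>E {-1, 1}.
     \<forall>x\<in>lattice n. real (card {y. lattice_adj n x y \<and> f y = 1}) / (2 * real n) = p}"

definition isomorphic ::
  "nat \<Rightarrow> ((nat \<Rightarrow> int) \<Rightarrow> int) \<Rightarrow> ((nat \<Rightarrow> int) \<Rightarrow> int) \<Rightarrow> bool" where
  "isomorphic n f g \<longleftrightarrow>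
     (\<exists>\<psi>. lattice_automorphism n \<psi> \<and> (\<forall>x\<in>lattice n. f (\<psi> x) = g x))"

definition nonisomorphic_class :: "nat \<Rightarrow> real \<Rightarrow> ((nat \<Rightarrow> int) \<Rightarrow> int) set \<Rightarrow> bool" where
  "nonisomorphic_class n p B \<longleftrightarrow>
     B \<subseteq> locally_biased n p \<and> pairwise (\<lambda>f g. \<not> isomorphic n f g) B"

definition maximal_nonisomorphic_class ::
  "nat \<Rightarrow> real \<Rightarrow> ((nat \<Rightarrow> int) \<Rightarrow> int) set \<Rightarrow> bool" where
  "maximal_nonisomorphic_class n p B \<longleftrightarrow> nonisomorphic_class n p B \<and>
     (\<forall>B'. nonisomorphic_class n p B' \<longrightarrow> B \<subseteq> B' \<longrightarrow> B' = B)"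

text \<open>
  The lower bound \<open>c \<le> |B|\<close> for a possibly infinite set; \<^const>\<open>card\<close> alone would
  give the value 0 on infinite sets.
\<close>

definition card_at_least :: "real \<Rightarrow> 'a set \<Rightarrow> bool" where
  "card_at_least c B \<longleftrightarrow> infinite B \<or> c \<le> real (card B)"

end

theory Submission
  imports Defs "HOL-Analysis.Finite_Cartesian_Product"
begin

text \<open>
  Both bounds hold because the classes in question are infinite. Let \<open>k \<ge> 2\<close> divide \<open>n\<close>. For an
  arbitrary set \<open>A\<close> of integers, let \<open>f\<close> be positive at \<open>x\<close> exactly when \<open>k\<close> divides
  \<open>(\<Sum>i<n. i * x i) + a(\<Sum>i<n. x i)\<close>, where \<open>a\<close> is the indicator of \<open>A\<close>. The \<open>n\<close> neighbours
  \<open>x + e\<^sub>i\<close> all have the same coordinate sum, so along them the value of \<open>a\<close> is constant while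
  the weighted sum runs through \<open>n\<close> consecutive integers; exactly \<open>n / k\<close> of them are positive. The
  same holds for the neighbours \<open>x - e\<^sub>i\<close>, so \<open>f\<close> is locally \<open>1 / k\<close>-biased, whatever \<open>A\<close> is:
  on each hyperplane of constant coordinate sum the colouring can be shifted independently of the
  others. Different sets \<open>A\<close> give different functions, hence there are uncountably many of them
  (\<open>uncountable_locally_biased\<close>).

  On the other hand the lattice graph has only countably many automorphisms, because an automorphism
  is determined by its values at the origin and at the neighbours of the origin
  (\<open>automorphism_eqI\<close>). Hence every isomorphism class is countable, and a maximal class of pairwise
  non-isomorphic functions, whose isomorphism classes cover all locally biased functions, cannot be
  finite. The cases \<open>k = 2\<close> and \<open>k = n\<close> are the two parts of the theorem.
\<close>

section \<open>The lattice graph\<close>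

lemma fun_upd_in_lattice: "x \<in> lattice n \<Longrightarrow> i < n \<Longrightarrow> x(i := v) \<in> lattice n"
  by (auto simp: lattice_def PiE_def extensional_def)

lemma lattice_eqI: "x \<in> lattice n \<Longrightarrow> y \<in> lattice n \<Longrightarrow> (\<And>j. j < n \<Longrightarrow> x j = y j) \<Longrightarrow> x = y"
  by (auto simp: lattice_def intro: PiE_ext)

lemma countable_lattice: "countable (lattice n)"
  unfolding lattice_def by (intro countable_PiE) auto

lemma lattice_adj_iff:
  "lattice_adj n x y \<longleftrightarrow> x \<in> lattice n \<and> (\<exists>i<n. \<exists>s\<in>{1, -1}. y = x(i := x i + s))"
proof
  assume "lattice_adj n x y"
  then obtain i s where x: "x \<in> lattice n" and y: "y \<in> lattice n" and i: "i < n"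
    and s: "s \<in> {1, -1}" and d: "\<forall>j<n. x j - y j = (if j = i then s else 0)"
    unfolding lattice_adj_def by blast
  have "y = x(i := x i + - s)"
    using d by (intro lattice_eqI[OF y fun_upd_in_lattice[OF x i]]) (smt (verit) fun_upd_apply)
  then show "x \<in> lattice n \<and> (\<exists>i<n. \<exists>s\<in>{1, -1}. y = x(i := x i + s))"
    using x i s by auto
next
  assume "x \<in> lattice n \<and> (\<exists>i<n. \<exists>s\<in>{1, -1}. y = x(i := x i + s))"
  then obtain i s where x: "x \<in> lattice n" and i: "i < n"
    and s: "s \<in> {1, -1}" and y: "y = x(i := x i + s)"
    by blast
  have "- s \<in> {1, -1}" and "\<forall>j<n. x j - y j = (if j = i then - s else 0)"
    using s y by auto
  then show "lattice_adj n x y"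
    unfolding lattice_adj_def using x i y fun_upd_in_lattice by blast
qed

lemma lattice_adj_sym: "lattice_adj n x y \<Longrightarrow> lattice_adj n y x"
  unfolding lattice_adj_iff by (force simp: fun_upd_in_lattice)

lemma finite_neighbours: "finite {y. lattice_adj n x y}"
proof -
  have "{y. lattice_adj n x y} \<subseteq> (\<lambda>(i, s). x(i := x i + s)) ` ({..<n} \<times> {1, -1})"
    by (auto simp: lattice_adj_iff image_iff)
  then show ?thesis by (rule finite_subset) simp
qed

lemma origin_in_lattice: "(\<lambda>i\<in>{..<n}. 0) \<in> lattice n"
  by (auto simp: lattice_def)

text \<open>
  The graph is connected: a nonzero point becomes closer to the origin, in the sum norm, when one of
  its nonzero coordinates is moved towards \<open>0\<close>.
\<close>

lemma lattice_induct [consumes 1, case_names origin neighbour]: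
  assumes "x \<in> lattice n"
    and origin: "P (\<lambda>i\<in>{..<n}. 0)"
    and neighbour: "\<And>x y. P x \<Longrightarrow> lattice_adj n x y \<Longrightarrow> P y"
  shows "P x"
  using assms(1)
proof (induction "\<Sum>i<n. nat \<bar>x i\<bar>" arbitrary: x rule: less_induct)
  case less
  show ?case
  proof (cases "\<forall>i<n. x i = 0")
    case True
    then have "x = (\<lambda>i\<in>{..<n}. 0)"
      by (intro lattice_eqI[OF less.prems origin_in_lattice]) auto
    then show ?thesis using origin by simp
  next
    case False
    then obtain i where i: "i < n" and nz: "x i \<noteq> 0" by blast
    define y where "y = x(i := x i + - sgn (x i))"
    have s: "- sgn (x i) \<in> {1, -1}" using nz by (auto simp: sgn_if)
    have adj: "lattice_adj n x y"
      unfolding lattice_adj_iff y_def using less.prems i s by blast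
    have "(\<Sum>j<n. nat \<bar>y j\<bar>) < (\<Sum>j<n. nat \<bar>x j\<bar>)"
    proof (rule sum_strict_mono_ex1)
      show "\<exists>j\<in>{..<n}. nat \<bar>y j\<bar> < nat \<bar>x j\<bar>"
        using i nz by (intro bexI[of _ i]) (auto simp: y_def sgn_if)
    qed (auto simp: y_def sgn_if)
    moreover have "y \<in> lattice n" using adj by (simp add: lattice_adj_def)
    ultimately have "P y" using less.hyps by blast
    then show ?thesis using neighbour lattice_adj_sym[OF adj] by blast
  qed
qed

text \<open>
  Two distinct points have at most two common neighbours: writing their difference as a sum of two
  signed unit vectors is possible in one way only, up to the order of the summands.
\<close>

lemma common_neighbour_cases:
  assumes "P \<noteq> Q"
    and "lattice_adj n P a" "lattice_adj n a Q"
    and "lattice_adj n P b" "lattice_adj n b Q"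
  shows "b = a \<or> (\<forall>j<n. b j = P j + Q j - a j)"
proof -
  obtain i s where i: "i < n" "s \<in> {1, -1}" and a: "a = P(i := P i + s)"
    using assms(2) unfolding lattice_adj_iff by blast
  obtain j t where j: "j < n" "t \<in> {1, -1}" and Q: "Q = a(j := a j + t)"
    using assms(3) unfolding lattice_adj_iff by blast
  obtain i' s' where i': "i' < n" "s' \<in> {1, -1}" and b: "b = P(i' := P i' + s')"
    using assms(4) unfolding lattice_adj_iff by blast
  obtain j' t' where j': "j' < n" "t' \<in> {1, -1}" and Q': "Q = b(j' := b j' + t')"
    using assms(5) unfolding lattice_adj_iff by blast
  define e where "e i s l = (if l = i then s else 0)" for i l :: nat and s :: int
  have D: "Q l - P l = e i s l + e j t l" for l
    by (auto simp: Q a e_def)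
  have D': "Q l - P l = e i' s' l + e j' t' l" for l
    by (auto simp: Q' b e_def)
  obtain l where "Q l \<noteq> P l" using assms(1) by force
  then have nz: "\<not> (i' = j' \<and> s' + t' = 0)" "\<not> (i = j \<and> s + t = 0)"
    using D[of l] D'[of l] by (auto simp: e_def split: if_splits)
  have E: "e i s l + e j t l = e i' s' l + e j' t' l" for l
    using D D' by metis
  have "(i' = i \<and> s' = s) \<or> (i' = j \<and> s' = t)"
    using E[of i'] E[of i] E[of j] nz i(2) j(2) i'(2) j'(2)
    by (auto simp: e_def split: if_splits)
  then show ?thesis
  proof (elim disjE conjE)
    assume "i' = i" "s' = s"
    then show ?thesis by (simp add: a b)
  next
    assume "i' = j" "s' = t"
    then show ?thesis by (auto simp: a b Q)
  qed
qed

section \<open>Automorphisms\<close>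

lemma automorphism_in_lattice:
  "lattice_automorphism n \<psi> \<Longrightarrow> x \<in> lattice n \<Longrightarrow> \<psi> x \<in> lattice n"
  by (auto simp: lattice_automorphism_def dest: bij_betwE)

lemma automorphism_adj:
  "lattice_automorphism n \<psi> \<Longrightarrow> lattice_adj n x y \<Longrightarrow> lattice_adj n (\<psi> x) (\<psi> y)"
  by (auto simp: lattice_automorphism_def lattice_adj_def)

lemma automorphism_eq_iff:
  "lattice_automorphism n \<psi> \<Longrightarrow> x \<in> lattice n \<Longrightarrow> y \<in> lattice n \<Longrightarrow> \<psi> x = \<psi> y \<longleftrightarrow> x = y"
  by (auto simp: lattice_automorphism_def bij_betw_def inj_on_def)

lemma automorphism_inv_into:
  assumes \<psi>: "lattice_automorphism n \<psi>"
  shows "lattice_automorphism n (inv_into (lattice n) \<psi>)" (is "lattice_automorphism n ?\<phi>")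
proof -
  have bij: "bij_betw ?\<phi> (lattice n) (lattice n)"
    using \<psi> by (simp add: lattice_automorphism_def bij_betw_inv_into)
  moreover have "lattice_adj n (?\<phi> x) (?\<phi> y) \<longleftrightarrow> lattice_adj n x y"
    if "x \<in> lattice n" "y \<in> lattice n" for x y
  proof -
    have "?\<phi> x \<in> lattice n" "?\<phi> y \<in> lattice n"
      using bij that by (auto dest: bij_betwE)
    then have "lattice_adj n (\<psi> (?\<phi> x)) (\<psi> (?\<phi> y)) \<longleftrightarrow> lattice_adj n (?\<phi> x) (?\<phi> y)"
      using \<psi> by (simp add: lattice_automorphism_def)
    moreover have "\<psi> (?\<phi> x) = x" "\<psi> (?\<phi> y) = y"
      using \<psi> that by (auto simp: lattice_automorphism_def bij_betw_inv_into_right)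
    ultimately show ?thesis by simp
  qed
  ultimately show ?thesis by (simp add: lattice_automorphism_def)
qed

lemma isomorphic_sym:
  assumes "isomorphic n f g"
  shows "isomorphic n g f"
proof -
  obtain \<psi> where \<psi>: "lattice_automorphism n \<psi>" and fg: "\<forall>x\<in>lattice n. f (\<psi> x) = g x"
    using assms by (auto simp: isomorphic_def)
  let ?\<phi> = "inv_into (lattice n) \<psi>"
  have \<phi>: "lattice_automorphism n ?\<phi>"
    using \<psi> by (rule automorphism_inv_into)
  have "g (?\<phi> x) = f x" if x: "x \<in> lattice n" for x
  proof -
    have "f (\<psi> (?\<phi> x)) = g (?\<phi> x)"
      using fg automorphism_in_lattice[OF \<phi> x] by blast
    moreover have "\<psi> (?\<phi> x) = x"
      using \<psi> x by (auto simp: lattice_automorphism_def bij_betw_inv_into_right)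
    ultimately show ?thesis by simp
  qed
  then show ?thesis
    using \<phi> by (auto simp: isomorphic_def)
qed

text \<open>
  Agreement of two automorphisms on a point and its neighbours propagates to the neighbours of every
  neighbour \<open>u\<close> of the point \<open>x\<close>. A neighbour of \<open>u\<close> off the line through \<open>x\<close> and \<open>u\<close> is
  the fourth corner of a \<open>4\<close>-cycle whose other corners have known images, and a \<open>4\<close>-cycle is
  determined by three of its corners. On the line there remains a single neighbour of \<open>u\<close>, whose
  image is then the only one left.
\<close>

lemma automorphism_agree_step:
  assumes \<psi>: "lattice_automorphism n \<psi>" and \<phi>: "lattice_automorphism n \<phi>"
    and x: "\<psi> x = \<phi> x" and nb: "\<And>y. lattice_adj n x y \<Longrightarrow> \<psi> y = \<phi> y"
    and u: "lattice_adj n x u" and z: "lattice_adj n u z"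
  shows "\<psi> z = \<phi> z"
proof -
  obtain i s where i: "i < n" "s \<in> {1, -1}" and u_eq: "u = x(i := x i + s)"
    using u unfolding lattice_adj_iff by blast
  have xl: "x \<in> lattice n" and ul: "u \<in> lattice n" and zl: "z \<in> lattice n"
    using u z by (auto simp: lattice_adj_def)
  have off_line: "\<psi> w = \<phi> w" if w: "lattice_adj n u w" "w \<noteq> u(i := u i + s)" for w
  proof -
    obtain j t where j: "j < n" "t \<in> {1, -1}" and w_eq: "w = u(j := u j + t)"
      using w(1) unfolding lattice_adj_iff by blast
    show ?thesis
    proof (cases "j = i")
      case True
      then have "w = x" using w(2) i(2) j(2) by (auto simp: w_eq u_eq)
      then show ?thesis using x by simp
    next
      case False
      define v where "v = x(j := x j + t)"
      have v: "lattice_adj n x v"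
        unfolding lattice_adj_iff v_def using xl j by blast
      have vl: "v \<in> lattice n" using v by (simp add: lattice_adj_def)
      have "w = v(i := v i + s)" using False by (auto simp: w_eq u_eq v_def)
      then have vw: "lattice_adj n v w"
        unfolding lattice_adj_iff using vl i by blast
      have wl: "w \<in> lattice n" using vw by (simp add: lattice_adj_def)
      have "u i \<noteq> v i" using False i(2) by (auto simp: u_eq v_def)
      then have "u \<noteq> v" by auto
      then have ne: "\<psi> u \<noteq> \<psi> v" using automorphism_eq_iff[OF \<psi>] ul vl by blast
      have "w i \<noteq> x i" using False i(2) by (auto simp: w_eq u_eq)
      then have "w \<noteq> x" by auto
      then have ne': "\<psi> w \<noteq> \<psi> x" "\<phi> w \<noteq> \<psi> x"
        using automorphism_eq_iff[OF \<psi> wl xl] automorphism_eq_iff[OF \<phi> wl xl] x by auto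
      have corner: "lattice_adj n (\<psi> u) (\<psi> x)" "lattice_adj n (\<psi> x) (\<psi> v)"
        using automorphism_adj[OF \<psi>] lattice_adj_sym u v by blast+
      have "lattice_adj n (\<psi> u) (\<psi> w)" "lattice_adj n (\<psi> w) (\<psi> v)"
        using automorphism_adj[OF \<psi>] lattice_adj_sym w vw by blast+
      then have 1: "\<forall>l<n. \<psi> w l = \<psi> u l + \<psi> v l - \<psi> x l"
        using common_neighbour_cases[OF ne corner] ne' by blast
      have "lattice_adj n (\<phi> u) (\<phi> w)" "lattice_adj n (\<phi> w) (\<phi> v)"
        using automorphism_adj[OF \<phi>] lattice_adj_sym w vw by blast+
      then have "lattice_adj n (\<psi> u) (\<phi> w)" "lattice_adj n (\<phi> w) (\<psi> v)"
        using nb[OF u] nb[OF v] by auto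
      then have 2: "\<forall>l<n. \<phi> w l = \<psi> u l + \<psi> v l - \<psi> x l"
        using common_neighbour_cases[OF ne corner] ne' by blast
      show ?thesis
        using 1 2 automorphism_in_lattice[OF \<psi> wl] automorphism_in_lattice[OF \<phi> wl]
        by (intro lattice_eqI) auto
    qed
  qed
  show ?thesis
  proof (cases "z = u(i := u i + s)")
    case False
    then show ?thesis using off_line z by blast
  next
    case True
    obtain z' where z': "z' \<in> lattice n" "\<phi> z' = \<psi> z"
      using \<phi> automorphism_in_lattice[OF \<psi> zl]
      by (auto simp: lattice_automorphism_def bij_betw_def image_iff dest!: equalityD2)
    have "lattice_adj n (\<phi> u) (\<phi> z')"
      using automorphism_adj[OF \<psi> z] nb[OF u] z'(2) by simp
    then have uz': "lattice_adj n u z'"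
      using \<phi> ul z'(1) by (simp add: lattice_automorphism_def)
    have "z' = z"
    proof (rule ccontr)
      assume "z' \<noteq> z"
      then have "\<psi> z' = \<phi> z'" using off_line[OF uz'] True by blast
      then show False using z' automorphism_eq_iff[OF \<psi> z'(1) zl] \<open>z' \<noteq> z\<close> by simp
    qed
    then show ?thesis using z'(2) by simp
  qed
qed

lemma automorphism_eqI:
  assumes \<psi>: "lattice_automorphism n \<psi>" and \<phi>: "lattice_automorphism n \<phi>"
    and origin: "\<psi> (\<lambda>i\<in>{..<n}. 0) = \<phi> (\<lambda>i\<in>{..<n}. 0)"
    and nb: "\<And>y. lattice_adj n (\<lambda>i\<in>{..<n}. 0) y \<Longrightarrow> \<psi> y = \<phi> y"
    and x: "x \<in> lattice n"
  shows "\<psi> x = \<phi> x"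
proof -
  have "\<psi> x = \<phi> x \<and> (\<forall>y. lattice_adj n x y \<longrightarrow> \<psi> y = \<phi> y)"
    using x
  proof (induction rule: lattice_induct)
    case origin
    then show ?case using assms by blast
  next
    case (neighbour x y)
    then show ?case using automorphism_agree_step[OF \<psi> \<phi>] by blast
  qed
  then show ?thesis ..
qed

lemma countable_automorphisms:
  "countable {restrict \<psi> (lattice n) | \<psi>. lattice_automorphism n \<psi>}" (is "countable ?Aut")
proof -
  define N where "N = insert (\<lambda>i\<in>{..<n}. 0) {y. lattice_adj n (\<lambda>i\<in>{..<n}. 0) y}"
  have N: "N \<subseteq> lattice n"
    using origin_in_lattice by (auto simp: N_def lattice_adj_def)
  have "countable (N \<rightarrow>\<^sub>E lattice n)"
    by (intro countable_PiE countable_lattice) (simp add: N_def finite_neighbours)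
  moreover have "(\<lambda>\<psi>. restrict \<psi> N) ` ?Aut \<subseteq> N \<rightarrow>\<^sub>E lattice n"
    using N automorphism_in_lattice by (auto simp: subset_iff)
  ultimately have "countable ((\<lambda>\<psi>. restrict \<psi> N) ` ?Aut)"
    by (rule countable_subset[rotated])
  moreover have "inj_on (\<lambda>\<psi>. restrict \<psi> N) ?Aut"
  proof (rule inj_onI, clarify)
    fix \<psi> \<phi>
    assume aut: "lattice_automorphism n \<psi>" "lattice_automorphism n \<phi>"
      and eq: "restrict (restrict \<psi> (lattice n)) N = restrict (restrict \<phi> (lattice n)) N"
    have N_eq: "\<psi> y = \<phi> y" if "y \<in> N" for y
      using fun_cong[OF eq, of y] that N by auto
    have "\<psi> x = \<phi> x" if "x \<in> lattice n" for x
      by (rule automorphism_eqI[OF aut N_eq N_eq that]) (auto simp only: N_def insert_iff mem_Collect_eq)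
    then show "restrict \<psi> (lattice n) = restrict \<phi> (lattice n)"
      by (intro restrict_ext)
  qed
  ultimately show ?thesis by (rule countable_image_inj_on)
qed

lemma countable_isomorphism_class:
  "countable {f \<in> locally_biased n p. isomorphic n b f}"
proof (rule countable_subset)
  show "{f \<in> locally_biased n p. isomorphic n b f} \<subseteq>
    (\<lambda>\<psi>. \<lambda>x\<in>lattice n. b (\<psi> x)) ` {restrict \<psi> (lattice n) | \<psi>. lattice_automorphism n \<psi>}"
  proof clarify
    fix f
    assume f: "f \<in> locally_biased n p" and "isomorphic n b f"
    then obtain \<psi> where \<psi>: "lattice_automorphism n \<psi>" "\<forall>x\<in>lattice n. b (\<psi> x) = f x"
      by (auto simp: isomorphic_def)
    have "f \<in> extensional (lattice n)"
      using f by (auto simp: locally_biased_def PiE_def)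
    then have "f = (\<lambda>x\<in>lattice n. b (restrict \<psi> (lattice n) x))"
      using \<psi>(2) by (intro extensionalityI[of _ "lattice n"]) auto
    then show "f \<in> (\<lambda>\<psi>. \<lambda>x\<in>lattice n. b (\<psi> x)) `
        {restrict \<psi> (lattice n) | \<psi>. lattice_automorphism n \<psi>}"
      using \<psi>(1) by blast
  qed
  show "countable ((\<lambda>\<psi>. \<lambda>x\<in>lattice n. b (\<psi> x)) `
      {restrict \<psi> (lattice n) | \<psi>. lattice_automorphism n \<psi>})"
    by (intro countable_image countable_automorphisms)
qed

section \<open>Uncountably many locally biased functions\<close>

text \<open>
  The layers are the sets of points with a given coordinate sum. The set \<open>A\<close> selects the layers
  whose colouring is shifted by one; the shifts need no compatibility with each other, because all
  neighbours of a point lie in the two adjacent layers and each of these contributes a constant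
  number of positive values on its own.
\<close>

definition layered :: "nat \<Rightarrow> nat \<Rightarrow> int set \<Rightarrow> (nat \<Rightarrow> int) \<Rightarrow> int" where
  "layered n k A = (\<lambda>x\<in>lattice n.
     if int k dvd (\<Sum>i<n. int i * x i) + of_bool ((\<Sum>i<n. x i) \<in> A) then 1 else -1)"

lemma sum_fun_upd_add:
  fixes x :: "nat \<Rightarrow> int"
  assumes "i < n"
  shows "(\<Sum>j<n. w j * (x(i := x i + s)) j) = (\<Sum>j<n. w j * x j) + w i * s"
proof -
  have "(\<Sum>j<n. w j * (x(i := x i + s)) j) = (\<Sum>j<n. w j * x j + (if j = i then w i * s else 0))"
    by (intro sum.cong) (auto simp: algebra_simps)
  also have "\<dots> = (\<Sum>j<n. w j * x j) + w i * s"
    using assms by (simp add: sum.distrib)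
  finally show ?thesis .
qed

lemma card_residue_class:
  assumes "k > 0"
  shows "card {i. i < k * q \<and> int k dvd int i - c} = q"
proof -
  define r where "r = nat (c mod int k)"
  have r: "int r = c mod int k" "r < k"
    using assms by (auto simp: r_def nat_less_iff)
  have "{i. i < k * q \<and> int k dvd int i - c} = (\<lambda>a. k * a + r) ` {..<q}"
  proof (intro equalityI subsetI)
    fix i assume "i \<in> {i. i < k * q \<and> int k dvd int i - c}"
    then have i: "i < k * q" "int i mod int k = int r"
      by (auto simp: r mod_eq_dvd_iff)
    then have "i mod k = r" by (simp flip: zmod_int)
    then have "i = k * (i div k) + r" by (metis mult_div_mod_eq)
    moreover have "i div k < q"
      using i(1) by (simp add: less_mult_imp_div_less mult.commute)
    ultimately show "i \<in> (\<lambda>a. k * a + r) ` {..<q}" by blast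
  next
    fix i assume "i \<in> (\<lambda>a. k * a + r) ` {..<q}"
    then obtain a where a: "a < q" "i = k * a + r" by auto
    have "k * a + r < k * Suc a" using r(2) by simp
    also have "\<dots> \<le> k * q" using a(1) by (intro mult_le_mono2) simp
    finally have "i < k * q" using a by simp
    moreover have "int i mod int k = c mod int k" using a r by simp
    ultimately show "i \<in> {i. i < k * q \<and> int k dvd int i - c}"
      by (simp add: mod_eq_dvd_iff)
  qed
  moreover have "inj_on (\<lambda>a. k * a + r) {..<q}"
    using assms by (auto simp: inj_on_def)
  ultimately show ?thesis by (simp add: card_image)
qed

lemma layered_locally_biased:
  assumes "k > 0" "q > 0"
  shows "layered (k * q) k A \<in> locally_biased (k * q) (1 / real k)"
proof -
  define n where "n = k * q"
  have range: "layered n k A \<in> lattice n \<rightarrow>\<^sub>E {-1, 1}"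
    by (auto simp: layered_def)
  have card: "card {y. lattice_adj n x y \<and> layered n k A y = 1} = 2 * q"
    if x: "x \<in> lattice n" for x
  proof -
    define c where "c s = (\<Sum>i<n. int i * x i) + of_bool ((\<Sum>i<n. x i) + s \<in> A)" for s
    \<comment> \<open>Multiplication by the unit \<open>s\<close> makes the coefficient of \<open>i\<close> in the divisibility
      condition \<open>1\<close>, so that for both signs it describes a residue class of \<open>i\<close>.\<close>
    define I where "I s = {i. i < n \<and> int k dvd int i - - s * c s}" for s
    have val: "layered n k A (x(i := x i + s)) = 1 \<longleftrightarrow> i \<in> I s"
      if i: "i < n" and s: "s \<in> {1, -1}" for i s
    proof -
      have "(\<Sum>j<n. (x(i := x i + s)) j) = (\<Sum>j<n. x j) + s"
        using sum_fun_upd_add[OF i, of "\<lambda>_. 1"] by simp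
      then have "(\<Sum>j<n. int j * (x(i := x i + s)) j) +
          of_bool ((\<Sum>j<n. (x(i := x i + s)) j) \<in> A) = c s + int i * s"
        unfolding sum_fun_upd_add[OF i] c_def by simp
      then have "layered n k A (x(i := x i + s)) = 1 \<longleftrightarrow> int k dvd c s + int i * s"
        using fun_upd_in_lattice[OF x i] by (simp add: layered_def del: fun_upd_apply)
      also have "c s + int i * s = s * (int i - - s * c s)"
        using s by auto
      also have "int k dvd \<dots> \<longleftrightarrow> int k dvd int i - - s * c s"
        using s by (auto simp: dvd_diff_commute)
      finally show ?thesis using i by (simp add: I_def fun_upd_def)
    qed
    have eq: "{y. lattice_adj n x y \<and> layered n k A y = 1} =
        (\<Union>s\<in>{1, -1}. (\<lambda>i. x(i := x i + s)) ` I s)"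
    proof (intro equalityI subsetI)
      fix y assume "y \<in> {y. lattice_adj n x y \<and> layered n k A y = 1}"
      then obtain i s where "i < n" and s: "s \<in> {1, -1}" and y: "y = x(i := x i + s)"
        and "layered n k A y = 1"
        unfolding lattice_adj_iff by blast
      then have "i \<in> I s" using val by blast
      then show "y \<in> (\<Union>s\<in>{1, -1}. (\<lambda>i. x(i := x i + s)) ` I s)"
        using s y by blast
    next
      fix y assume "y \<in> (\<Union>s\<in>{1, -1}. (\<lambda>i. x(i := x i + s)) ` I s)"
      then obtain i s where s: "s \<in> {1, -1}" and i: "i \<in> I s" and y: "y = x(i := x i + s)"
        by blast
      have "i < n" using i by (simp add: I_def)
      then show "y \<in> {y. lattice_adj n x y \<and> layered n k A y = 1}"
        using val[of i s] x s i y unfolding lattice_adj_iff by blast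
    qed
    have inj: "inj_on (\<lambda>i. x(i := x i + s)) (I s)" if "s \<in> {1, -1}" for s
      using that by (auto simp: inj_on_def fun_eq_iff split: if_splits)
    have I: "finite (I s)" "card (I s) = q" for s
      using card_residue_class[OF assms(1), of q "- s * c s"] by (simp_all add: I_def n_def)
    have disj: "x(i := x i + 1) \<noteq> x(j := x j + -1)" for i j
      by (auto simp: fun_eq_iff split: if_splits)
    have "card (\<Union>s\<in>{1, -1}. (\<lambda>i. x(i := x i + s)) ` I s) =
        (\<Sum>s\<in>{1, -1}. card ((\<lambda>i. x(i := x i + s)) ` I s))"
      using disj I by (intro card_UN_disjoint) (auto, metis+)
    also have "\<dots> = (\<Sum>s\<in>{1, -1::int}. q)"
      using inj I by (intro sum.cong) (auto simp: card_image)
    finally show ?thesis using eq by simp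
  qed
  have "real (2 * q) / (2 * real n) = 1 / real k"
    using assms by (simp add: n_def)
  then show ?thesis
    using range card by (simp add: locally_biased_def flip: n_def)
qed

text \<open>
  The witness separating \<open>A\<close> from \<open>B\<close> is supported on the coordinates with weights \<open>0\<close> and
  \<open>1\<close>, so that its coordinate sum and its weighted sum can be prescribed independently.
\<close>

lemma layered_inj:
  assumes "k \<ge> 2" "n \<ge> 2"
  shows "inj (layered n k)"
proof -
  have "s \<in> B" if eq: "layered n k A = layered n k B" and s: "s \<in> A" for A B s
  proof -
    define x where "x = (\<lambda>i\<in>{..<n}. if i = 0 then s + 1 else if i = 1 then - 1 else 0 :: int)"
    have x: "x \<in> lattice n" by (auto simp: lattice_def x_def)
    have "{..<n} = {0, 1} \<union> {2..<n}" using assms(2) by auto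
    moreover have "{0, 1} \<inter> {2..<n} = {}" by auto
    ultimately have sum_split: "(\<Sum>i<n. g i) = g 0 + g 1 + (\<Sum>i=2..<n. g i)" for g :: "nat \<Rightarrow> int"
      by (simp add: sum.union_disjoint)
    have "(\<Sum>i<n. x i) = s" "(\<Sum>i<n. int i * x i) = - 1"
      unfolding sum_split using assms(2) by (auto simp: x_def)
    then have val: "layered n k A x = (if int k dvd - 1 + of_bool (s \<in> A) then 1 else - 1)" for A
      using x by (simp add: layered_def)
    have "\<not> int k dvd - 1" using assms(1) by simp
    then show ?thesis
      using val[of A] val[of B] eq s by (cases "s \<in> B") auto
  qed
  then show ?thesis by (intro injI equalityI subsetI) metis+
qed

lemma uncountable_locally_biased:
  assumes "k \<ge> 2" "k dvd n" "n > 0"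
  shows "uncountable (locally_biased n (1 / real k))"
proof
  obtain q where q: "n = k * q" using assms(2) by blast
  assume "countable (locally_biased n (1 / real k))"
  moreover have "range (layered n k) \<subseteq> locally_biased n (1 / real k)"
    using assms(1,3) layered_locally_biased by (auto simp: q)
  ultimately have "countable (range (layered n k))"
    by (rule countable_subset[rotated])
  moreover have "inj (layered n k)"
    using dvd_imp_le[OF assms(2,3)] assms(1) by (intro layered_inj) simp_all
  ultimately have "countable (UNIV :: int set set)"
    by (rule countable_image_inj_on)
  then have surj: "range (from_nat_into (UNIV :: int set set)) = UNIV"
    by (intro range_from_nat_into) auto
  have "X \<in> range (\<lambda>z :: int. from_nat_into UNIV (nat z))" for X :: "int set"
  proof -
    obtain m where "X = from_nat_into UNIV m"
      using surj by blast
    then show ?thesis by (intro image_eqI[of _ _ "int m"]) simp_all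
  qed
  then have "range (\<lambda>z :: int. from_nat_into UNIV (nat z)) = Pow (UNIV :: int set)"
    by blast
  then show False using Cantors_theorem by blast
qed

section \<open>Maximal classes\<close>

lemma maximal_class_covers:
  assumes "maximal_nonisomorphic_class n p B" and f: "f \<in> locally_biased n p"
  shows "\<exists>b\<in>B. isomorphic n b f"
proof (cases "f \<in> B")
  case True
  have "lattice_automorphism n id" by (simp add: lattice_automorphism_def)
  then have "isomorphic n f f" by (auto simp: isomorphic_def)
  then show ?thesis using True by blast
next
  case False
  have B: "nonisomorphic_class n p B"
    and max: "\<And>B'. nonisomorphic_class n p B' \<Longrightarrow> B \<subseteq> B' \<Longrightarrow> B' = B"
    using assms(1) by (auto simp: maximal_nonisomorphic_class_def)
  have "\<not> nonisomorphic_class n p (insert f B)"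
    using max[of "insert f B"] False by blast
  then have "\<exists>b\<in>B. isomorphic n b f \<or> isomorphic n f b"
    using B f by (auto simp: nonisomorphic_class_def pairwise_insert)
  then show ?thesis using isomorphic_sym by blast
qed

lemma maximal_class_uncountable:
  assumes max: "maximal_nonisomorphic_class n (1 / real k) B"
    and "k \<ge> 2" "k dvd n" "n > 0"
  shows "uncountable B"
proof
  assume "countable B"
  then have "countable (\<Union>b\<in>B. {f \<in> locally_biased n (1 / real k). isomorphic n b f})"
    by (intro countable_UN countable_isomorphism_class)
  moreover have "locally_biased n (1 / real k) \<subseteq>
      (\<Union>b\<in>B. {f \<in> locally_biased n (1 / real k). isomorphic n b f})"
    using maximal_class_covers[OF max] by blast
  ultimately show False
    using uncountable_locally_biased[OF assms(2-4)] countable_subset by blast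
qed

theorem corollary5p6:
  shows "(\<exists>C::real. C > 0 \<and>
            (\<forall>n::nat. n > 0 \<longrightarrow> even n \<longrightarrow>
               (\<forall>B. maximal_nonisomorphic_class n (1 / 2) B \<longrightarrow>
                  card_at_least (C * 2 powr sqrt (real n) / real n powr (1 / 4)) B)))
       \<and> (\<forall>A::real. A > 1 \<longrightarrow>
            (\<exists>M::nat. \<forall>m\<ge>M. \<forall>n::nat. n = 2 ^ m \<longrightarrow>
               (\<forall>B. maximal_nonisomorphic_class n (1 / real n) B \<longrightarrow>
                  card_at_least (A ^ n) B)))"
proof (intro conjI exI[of _ "1 :: real"] exI[of _ "1 :: nat"] allI impI)
  show "(0 :: real) < 1" by simp
next
  fix n :: nat and B
  assume "n > 0" "even n" "maximal_nonisomorphic_class n (1 / 2) B"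
  then have "uncountable B"
    using maximal_class_uncountable[of n 2 B] by simp
  then show "card_at_least (1 * 2 powr sqrt (real n) / real n powr (1 / 4)) B"
    using countable_finite by (auto simp: card_at_least_def)
next
  fix A :: real and m n :: nat and B
  assume m: "1 \<le> m" "n = 2 ^ m" and max: "maximal_nonisomorphic_class n (1 / real n) B"
  have "(2::nat) ^ 1 \<le> 2 ^ m" using m(1) by (intro power_increasing) auto
  then have "n \<ge> 2" using m(2) by simp
  then have "uncountable B"
    by (intro maximal_class_uncountable[OF max]) auto
  then show "card_at_least (A ^ n) B"
    using countable_finite by (auto simp: card_at_least_def)
qed

end
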